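(* There exists a lattice polytope of dimension $14$ in $\mathbb{R}^{14}$ that is hollow with respect to $\mathbb{Z}^{14}$ and has lattice width $15$, and there exists a lattice simplex of dimension $404$ in $\mathbb{R}^{404}$ that is hollow with respect to $\mathbb{Z}^{404}$ and has lattice width $408$.
   Context: A lattice polytope is a polytope whose vertices lie in the lattice. A convex body $K\subset\mathbb{R}^d$ is hollow with respect to $\mathbb{Z}^d$ if its interior contains no point of $\mathbb{Z}^d$. The lattice width of $K$ is $\inf_{f\in(\mathbb{Z}^d)^*\setminus\{0\}}(\max_K f-\min_K f)$, the infimum over nonzero integer linear functionals. *)

theory Defs
  imports "HOL-Analysis.Analysis"
begin

definition integer_lattice :: "(real ^ 'n) set" where
  "integer_lattice = {x. \<forall>i. x $ i \<in> \<int>}"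

definition lattice_polytope :: "(real ^ 'n) set \<Rightarrow> bool" where
  "lattice_polytope P \<longleftrightarrow> polytope P \<and> {v. v extreme_point_of P} \<subseteq> integer_lattice"

definition hollow :: "(real ^ 'n) set \<Rightarrow> bool" where
  "hollow K \<longleftrightarrow> interior K \<inter> integer_lattice = {}"

text \<open>The dual lattice: an integer linear functional on the lattice is identified with its
  unique real-linear extension to the whole space.\<close>

definition dual_lattice :: "(real ^ 'n \<Rightarrow> real) set" where
  "dual_lattice = {f. linear f \<and> f ` integer_lattice \<subseteq> \<int>}"

text \<open>For a nonempty compact \<open>K\<close> the supremum and infimum of \<open>f\<close> over \<open>K\<close> are attained, and the
  outer infimum is over a nonempty set of nonnegative reals; elsewhere the value is meaningless.\<close>

definition lattice_width :: "(real ^ 'n) set \<Rightarrow> real" where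
  "lattice_width K = (INF f \<in> dual_lattice - {\<lambda>x. 0}. (SUP x\<in>K. f x) - (INF x\<in>K. f x))"

end

theory Submission
  imports Defs
begin

text \<open>Both polytopes are free sums of \<open>m\<close> copies of one low-dimensional lattice polytope \<open>Q\<close>
  that contains the origin and has no point of \<open>m\<int>\<^sup>d\<close> in its interior. If a lattice point \<open>z\<close> were
  interior to the free sum, the gauges of \<open>Q\<close> at the \<open>m\<close> blocks of \<open>z\<close> would add up to less
  than \<open>1\<close>, so one of them would be less than \<open>1/m\<close> and \<open>m\<close> times that block would be interior
  to \<open>Q\<close>. The free sum inherits the lattice width of \<open>Q\<close>, since a nonzero functional is nonzero on
  some block.

  For dimension 14 the summand is a triangle of width 15, an integral approximation of 7 times the
  planar hollow triangle of largest width (Hurkens). For dimension 404 it is \<open>102\<close> times the empty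
  lattice 4-simplex of normalized volume 101 and width 4 (Haase and Ziegler), taken 101 times. The
  barycentric coordinates of lattice points with respect to the empty simplex are multiples of
  \<open>1/101\<close>, so dilating it by \<open>102/101\<close> from a vertex creates no interior lattice point.\<close>

section \<open>Integer functionals as inner products with lattice vectors\<close>

lemma dual_lattice_inner:
  fixes f :: "real ^ 'n \<Rightarrow> real"
  assumes "f \<in> dual_lattice"
  obtains c :: "real ^ 'n" where "c \<in> integer_lattice" "f = (\<lambda>x. c \<bullet> x)"
proof
  have lin: "linear f" and int: "f ` integer_lattice \<subseteq> \<int>"
    using assms by (auto simp: dual_lattice_def)
  let ?c = "\<chi> i. f (axis i 1)"
  have "axis i 1 \<in> integer_lattice" for i :: 'n
    by (simp add: integer_lattice_def axis_def)
  then show "?c \<in> integer_lattice"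
    using int by (auto simp: integer_lattice_def)
  have "f x = ?c \<bullet> x" for x
  proof -
    have "f x = f (\<Sum>i\<in>UNIV. x $ i *s axis i 1)"
      by (simp add: basis_expansion)
    also have "\<dots> = (\<Sum>i\<in>UNIV. x $ i * f (axis i 1))"
      by (simp add: linear_sum[OF lin] linear_cmul[OF lin] scalar_mult_eq_scaleR)
    finally show ?thesis by (simp add: inner_vec_def mult.commute)
  qed
  then show "f = (\<lambda>x. ?c \<bullet> x)" by blast
qed

lemma inner_lattice:
  fixes c x :: "real ^ 'n"
  shows "c \<in> integer_lattice \<Longrightarrow> x \<in> integer_lattice \<Longrightarrow> c \<bullet> x \<in> \<int>"
  by (auto simp: integer_lattice_def inner_vec_def intro!: Ints_sum)

lemma inner_in_dual_lattice:
  fixes c :: "real ^ 'n"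
  shows "c \<in> integer_lattice \<Longrightarrow> (\<lambda>x. c \<bullet> x) \<in> dual_lattice"
  by (auto simp: dual_lattice_def inner_lattice bounded_linear_inner_right bounded_linear.linear)

section \<open>Free powers\<close>

context
  fixes h :: "'n::finite \<Rightarrow> 'b::finite \<times> 'd::finite"
  assumes bij_h: "bij h"
begin

text \<open>The bijection \<open>h\<close> regroups the coordinates as pairs of a block and a
  position in it, so the free sum lives in \<open>real ^ 'n\<close> itself.\<close>

definition block_embed :: "'b \<Rightarrow> real ^ 'd \<Rightarrow> real ^ 'n" where
  "block_embed j u = (\<chi> i. if fst (h i) = j then u $ snd (h i) else 0)"

definition block :: "'b \<Rightarrow> real ^ 'n \<Rightarrow> real ^ 'd" where
  "block j x = (\<chi> k. x $ inv h (j, k))"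

definition generators :: "(real ^ 'd) set \<Rightarrow> (real ^ 'n) set" where
  "generators U = (\<Union>j. block_embed j ` U)"

definition free_power :: "(real ^ 'd) set \<Rightarrow> (real ^ 'n) set" where
  "free_power U = convex hull generators U"

lemma h_inv: "h (inv h p) = p"
  using bij_h by (simp add: bij_is_surj surj_f_inv_f)

lemma block_eq_0_imp: "(\<And>j. block j x = 0) \<Longrightarrow> x = 0"
proof -
  assume a: "\<And>j. block j x = 0"
  have "x $ i = 0" for i
  proof -
    have "block (fst (h i)) x $ snd (h i) = x $ i"
      using bij_h by (simp add: block_def bij_is_inj)
    then show ?thesis using a by simp
  qed
  then show "x = 0" by (simp add: vec_eq_iff)
qed

lemma block_lattice: "x \<in> integer_lattice \<Longrightarrow> block j x \<in> integer_lattice"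
  by (simp add: integer_lattice_def block_def)

lemma block_embed_lattice: "u \<in> integer_lattice \<Longrightarrow> block_embed j u \<in> integer_lattice"
  by (simp add: integer_lattice_def block_embed_def)

lemma block_block_embed: "block j (block_embed k u) = (if j = k then u else 0)"
  by (simp add: block_def block_embed_def h_inv vec_eq_iff)

lemma block_embed_0 [simp]: "block_embed j 0 = 0"
  by (simp add: block_embed_def vec_eq_iff)

text \<open>Adjointness moves pairings on the free sum to the summand.\<close>

lemma inner_block_embed: "block_embed j u \<bullet> x = u \<bullet> block j x"
proof -
  have "block_embed j u \<bullet> x = (\<Sum>i\<in>UNIV. (if fst (h i) = j then u $ snd (h i) else 0) * x $ i)"
    by (simp add: inner_vec_def block_embed_def)
  also have "\<dots> = (\<Sum>p\<in>UNIV. (if fst p = j then u $ snd p else 0) * x $ inv h p)"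
    using sum.reindex_bij_betw[OF bij_h,
        of "\<lambda>p. (if fst p = j then u $ snd p else 0) * x $ inv h p"] bij_h
    by (simp add: bij_is_inj)
  also have "\<dots> = (\<Sum>a\<in>UNIV. \<Sum>k\<in>UNIV. (if a = j then u $ k else 0) * x $ inv h (a, k))"
    by (simp add: sum.cartesian_product case_prod_beta UNIV_Times_UNIV)
  also have "\<dots> = (\<Sum>a\<in>UNIV. if a = j then \<Sum>k\<in>UNIV. u $ k * x $ inv h (a, k) else 0)"
    by (intro sum.cong) auto
  also have "\<dots> = u \<bullet> block j x"
    by (simp add: inner_vec_def block_def)
  finally show ?thesis .
qed

lemma generators_subset: "generators U \<subseteq> free_power U"
  by (simp add: free_power_def hull_subset)

lemma generators_lattice: "U \<subseteq> integer_lattice \<Longrightarrow> generators U \<subseteq> integer_lattice"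
  by (auto simp: generators_def block_embed_lattice)

lemma finite_generators: "finite U \<Longrightarrow> finite (generators U)"
  by (simp add: generators_def)

lemma lattice_polytope_free_power:
  assumes "finite U" "U \<subseteq> integer_lattice"
  shows "lattice_polytope (free_power U)"
  using assms generators_lattice[of U] finite_generators[of U]
    extreme_points_of_convex_hull[of "generators U"]
  unfolding lattice_polytope_def polytope_def free_power_def by blast

lemma free_power_halfspace:
  assumes "\<And>j u. u \<in> U \<Longrightarrow> a \<bullet> block_embed j u \<le> b"
  shows "free_power U \<subseteq> {x. a \<bullet> x \<le> b}"
  unfolding free_power_def
  by (rule hull_minimal) (use assms in \<open>auto simp: generators_def convex_halfspace_le\<close>)

text \<open>For \<open>a \<noteq> 0\<close> the interior of the closed halfspace is the open
  one.\<close>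

lemma interior_free_power_strict:
  assumes "\<And>j u. u \<in> U \<Longrightarrow> a \<bullet> block_embed j u \<le> b" "a \<noteq> 0" "x \<in> interior (free_power U)"
  shows "a \<bullet> x < b"
  using interior_mono[OF free_power_halfspace[of U a b]] assms by (auto simp: interior_halfspace_le)

text \<open>\<open>A\<close> holds the facets of the summand through the origin, \<open>B\<close> the other ones, scaled to
  right-hand side \<open>1\<close>.\<close>

lemma hollow_free_power:
  assumes A: "\<And>g u. g \<in> A \<Longrightarrow> u \<in> U \<Longrightarrow> g \<bullet> u \<le> 0" "0 \<notin> A"
    and B: "\<And>g u. g \<in> B \<Longrightarrow> u \<in> U \<Longrightarrow> g \<bullet> u \<le> 1"
    and z: "\<And>z. z \<in> integer_lattice \<Longrightarrow>
      (\<exists>g\<in>A. g \<bullet> z \<ge> 0) \<or> (\<exists>g\<in>B. g \<bullet> z \<ge> 1 / CARD('b))"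
  shows "hollow (free_power U)"
proof -
  have False if x: "x \<in> interior (free_power U)" "x \<in> integer_lattice" for x
  proof (cases "\<exists>j. \<exists>g\<in>A. g \<bullet> block j x \<ge> 0")
    case True
    then obtain j g where g: "g \<in> A" "g \<bullet> block j x \<ge> 0" by blast
    have "block j (block_embed j g) \<noteq> 0"
      using g A(2) by (auto simp: block_block_embed)
    then have ne: "block_embed j g \<noteq> 0"
      by (auto simp: block_def vec_eq_iff)
    have "block_embed j g \<bullet> x < 0"
      by (rule interior_free_power_strict[OF _ ne x(1)])
        (use A(1) g in \<open>auto simp: inner_block_embed block_block_embed\<close>)
    then show False using g by (simp add: inner_block_embed)
  next
    case False
    then have "\<forall>j. \<exists>g\<in>B. g \<bullet> block j x \<ge> 1 / CARD('b)"
      using z block_lattice[OF x(2)] by blast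
    then obtain g where g: "\<And>j. g j \<in> B" "\<And>j. g j \<bullet> block j x \<ge> 1 / CARD('b)"
      by metis
    \<comment> \<open>One functional chosen per block. A generator lives in a single block, so
      \<open>a\<close> is at most 1 on the free sum, while the \<open>CARD('b)\<close> blocks of
      \<open>x\<close> contribute at least \<open>1 / CARD('b)\<close> each.\<close>
    define a where "a = (\<Sum>j\<in>UNIV. block_embed j (g j))"
    have "a \<bullet> x \<ge> (\<Sum>j\<in>(UNIV::'b set). 1 / CARD('b))"
      unfolding a_def inner_sum_left inner_block_embed by (rule sum_mono) (rule g)
    then have ax: "a \<bullet> x \<ge> 1" by simp
    then have "a \<noteq> 0" by auto
    have "a \<bullet> x < 1"
    proof (rule interior_free_power_strict[OF _ \<open>a \<noteq> 0\<close> x(1)])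
      fix j u assume "u \<in> U"
      have "a \<bullet> block_embed j u = (\<Sum>i\<in>UNIV. if i = j then g i \<bullet> u else 0)"
        unfolding a_def inner_sum_left inner_block_embed
        by (intro sum.cong) (auto simp: block_block_embed)
      then show "a \<bullet> block_embed j u \<le> 1"
        using B[OF g(1) \<open>u \<in> U\<close>] by simp
    qed
    then show False using ax by simp
  qed
  then show ?thesis by (auto simp: hollow_def)
qed

text \<open>A vector orthogonal to all generators has every block orthogonal to \<open>U\<close>,
  hence zero. Since \<open>0\<close> is a generator, affine dimension is the dimension of the
  span.\<close>

lemma aff_dim_generators:
  assumes "0 \<in> U" and nd: "\<And>a. (\<And>u. u \<in> U \<Longrightarrow> a \<bullet> u = 0) \<Longrightarrow> a = 0"
  shows "aff_dim (generators U) = CARD('n)"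
proof -
  have "span (generators U) = UNIV"
  proof (rule ccontr)
    assume "span (generators U) \<noteq> UNIV"
    then obtain a where a: "a \<noteq> 0" "\<And>x. x \<in> span (generators U) \<Longrightarrow> a \<bullet> x = 0"
      using span_not_UNIV_orthogonal by blast
    have "block j a = 0" for j
    proof (rule nd)
      fix u assume "u \<in> U"
      then have "block_embed j u \<in> span (generators U)"
        by (auto simp: generators_def intro: span_base)
      then show "block j a \<bullet> u = 0"
        using a(2) by (metis inner_block_embed inner_commute)
    qed
    then show False using block_eq_0_imp a(1) by blast
  qed
  moreover have "0 \<in> generators U"
    using assms(1) by (force simp: generators_def intro: rev_image_eqI)
  ultimately show ?thesis
    by (metis aff_dim_zero dim_UNIV dim_span hull_inc DIM_cart DIM_real mult.right_neutral)
qed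

text \<open>All blocks share the generator \<open>0\<close>, which leaves at most
  \<open>CARD('n) + 1\<close> generators. Full affine dimension needs at least that many, so they
  are affinely independent.\<close>

lemma simplex_free_power:
  assumes "finite U" "0 \<in> U" and nd: "\<And>a. (\<And>u. u \<in> U \<Longrightarrow> a \<bullet> u = 0) \<Longrightarrow> a = 0"
    and card: "card U \<le> CARD('d) + 1"
  shows "int CARD('n) simplex free_power U"
proof -
  have "generators U \<subseteq> insert 0 ((\<lambda>(j, u). block_embed j u) ` (UNIV \<times> (U - {0})))"
    by (force simp: generators_def)
  then have "card (generators U) \<le> card (insert 0 ((\<lambda>(j, u). block_embed j u) ` (UNIV \<times> (U - {0}))))"
    by (rule card_mono[rotated]) (use assms(1) in auto)
  also have "\<dots> \<le> Suc (card ((\<lambda>(j, u). block_embed j u) ` (UNIV \<times> (U - {0}))))"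
    by (rule card_insert_le_m1) auto
  also have "\<dots> \<le> Suc (CARD('b) * card (U - {0}))"
    using card_image_le[of "UNIV \<times> (U - {0})" "\<lambda>(j, u). block_embed j u"] assms(1)
    by (simp add: card_cartesian_product)
  also have "\<dots> \<le> Suc (CARD('b) * CARD('d))"
    using assms(1,2) card by (simp add: card_Diff_singleton)
  also have "CARD('b) * CARD('d) = CARD('n)"
    using bij_betw_same_card[OF bij_h] by simp
  finally have le: "card (generators U) \<le> CARD('n) + 1" by simp
  have fin: "finite (generators U)" by (rule finite_generators[OF assms(1)])
  have ad: "aff_dim (generators U) = CARD('n)" by (rule aff_dim_generators[OF assms(2) nd])
  then have eq: "int (card (generators U)) = CARD('n) + 1"
    using aff_dim_le_card[OF fin] le by simp
  then have "\<not> affine_dependent (generators U)"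
    using fin ad by (simp add: affine_independent_iff_card)
  then show ?thesis
    unfolding simplex_def free_power_def using eq by auto
qed

text \<open>Every nonzero functional already has the required width on a block where it is nonzero;
  placing \<open>c\<close> on a single block attains it. The interval must contain \<open>0\<close>,
  the value at the generators of all other blocks.\<close>

lemma lattice_width_free_power:
  assumes fin: "finite U"
    and low: "\<And>c. c \<in> integer_lattice \<Longrightarrow> c \<noteq> 0 \<Longrightarrow> \<exists>u\<in>U. \<exists>v\<in>U. c \<bullet> u - c \<bullet> v \<ge> \<beta> - \<alpha>"
    and c: "c \<in> integer_lattice" "c \<noteq> 0"
    and up: "\<And>u. u \<in> U \<Longrightarrow> c \<bullet> u \<in> {\<alpha>..\<beta>}" "0 \<in> {\<alpha>..\<beta>}"
  shows "lattice_width (free_power U) = \<beta> - \<alpha>"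
proof -
  let ?P = "free_power U"
  have wd: "\<beta> - \<alpha> \<le> (SUP x\<in>?P. f x) - (INF x\<in>?P. f x)" if f: "f \<in> dual_lattice - {\<lambda>x. 0}" for f
  proof -
    obtain e where e: "e \<in> integer_lattice" "f = (\<lambda>x. e \<bullet> x)"
      using dual_lattice_inner f by blast
    then have "e \<noteq> 0" using f by auto
    then obtain j where "block j e \<noteq> 0" using block_eq_0_imp by blast
    then obtain u v where uv: "u \<in> U" "v \<in> U" "block j e \<bullet> u - block j e \<bullet> v \<ge> \<beta> - \<alpha>"
      using low block_lattice[OF e(1)] by blast
    have comp: "compact (f ` ?P)"
      unfolding free_power_def e(2)
      by (intro compact_continuous_image continuous_intros compact_convex_hull
          finite_imp_compact finite_generators fin)
    have mem: "block_embed j u \<in> ?P" "block_embed j v \<in> ?P"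
      using uv generators_subset by (auto simp: generators_def)
    have "f (block_embed j u) \<le> (SUP x\<in>?P. f x)" "(INF x\<in>?P. f x) \<le> f (block_embed j v)"
      using comp mem by (auto intro!: cSUP_upper cINF_lower
          bounded_imp_bdd_above bounded_imp_bdd_below compact_imp_bounded)
    moreover have "f (block_embed j w) = block j e \<bullet> w" for w
      unfolding e(2) by (metis inner_block_embed inner_commute)
    ultimately show ?thesis using uv(3) by simp
  qed
  obtain j :: 'b where True by simp
  define f where "f = (\<lambda>x. block_embed j c \<bullet> x)"
  obtain u where u: "u \<in> U" using low c by blast
  have ne: "?P \<noteq> {}" using u generators_subset by (auto simp: generators_def)
  have gen: "f (block_embed k u) \<in> {\<alpha>..\<beta>}" if "u \<in> U" for k u
    using up that by (auto simp: f_def inner_block_embed block_block_embed)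
  have "?P \<subseteq> {x. f x \<le> \<beta>}"
    unfolding f_def by (rule free_power_halfspace) (use gen in \<open>auto simp: f_def\<close>)
  moreover have "?P \<subseteq> {x. - block_embed j c \<bullet> x \<le> - \<alpha>}"
    by (rule free_power_halfspace) (use gen in \<open>auto simp: f_def\<close>)
  ultimately have bd: "(SUP x\<in>?P. f x) \<le> \<beta>" "\<alpha> \<le> (INF x\<in>?P. f x)"
    using ne by (auto intro!: cSUP_least cINF_greatest simp: f_def)
  have f: "f \<in> dual_lattice - {\<lambda>x. 0}"
  proof -
    have "f (block_embed j c) = c \<bullet> c" by (simp add: f_def inner_block_embed block_block_embed)
    then have "f \<noteq> (\<lambda>x. 0)" using c by auto
    then show ?thesis using c inner_in_dual_lattice block_embed_lattice by (auto simp: f_def)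
  qed
  show ?thesis
    unfolding lattice_width_def
  proof (rule antisym)
    have "(INF f\<in>dual_lattice - {\<lambda>x. 0}. (SUP x\<in>?P. f x) - (INF x\<in>?P. f x))
        \<le> (SUP x\<in>?P. f x) - (INF x\<in>?P. f x)"
      by (rule cINF_lower[OF _ f]) (use wd in \<open>auto intro!: bdd_belowI2\<close>)
    then show "(INF f\<in>dual_lattice - {\<lambda>x. 0}. (SUP x\<in>?P. f x) - (INF x\<in>?P. f x)) \<le> \<beta> - \<alpha>"
      using bd by linarith
    show "\<beta> - \<alpha> \<le> (INF f\<in>dual_lattice - {\<lambda>x. 0}. (SUP x\<in>?P. f x) - (INF x\<in>?P. f x))"
      by (rule cINF_greatest) (use f wd in auto)
  qed
qed

end

lemma blocks_exist:
  assumes "CARD('n) = CARD('b) * CARD('d)"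
  obtains h :: "'n::finite \<Rightarrow> 'b::finite \<times> 'd::finite" where "bij h"
proof -
  have "\<exists>h :: 'n \<Rightarrow> 'b \<times> 'd. bij_betw h UNIV UNIV"
    by (rule finite_same_card_bij) (use assms in \<open>auto simp: card_cartesian_product simp flip: UNIV_Times_UNIV\<close>)
  then show ?thesis using that by auto
qed

section \<open>The triangle\<close>

text \<open>The origin is no vertex: it lies on the edge from \<open>(-6, 9)\<close> to
  \<open>(4, -6)\<close>.\<close>

definition triangle :: "(real ^ 2) set" where
  "triangle = {0, vector [-6, 9], vector [4, -6], vector [9, 4]}"

lemma inner_2: "(x :: real ^ 2) \<bullet> y = x $ 1 * y $ 1 + x $ 2 * y $ 2"
  by (simp add: inner_vec_def sum_2)

lemma lattice_2:
  assumes "(z :: real ^ 2) \<in> integer_lattice"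
  obtains a b :: int where "z $ 1 = a" "z $ 2 = b"
  using assms by (auto simp: integer_lattice_def forall_2 elim!: Ints_cases)

lemma triangle_hollow:
  fixes z :: "real ^ 2"
  assumes "z \<in> integer_lattice"
  shows "(\<exists>g\<in>{vector [-3, -2]}. g \<bullet> z \<ge> 0) \<or>
    (\<exists>g\<in>{vector [1/7, -1/14], vector [1/21, 1/7]}. g \<bullet> z \<ge> 1 / CARD(7))"
proof -
  obtain a b :: int where ab: "z $ 1 = a" "z $ 2 = b" using lattice_2[OF assms] .
  \<comment> \<open>The three edge inequalities with denominators cleared.\<close>
  have "3 * a + 2 * b \<le> 0 \<or> 2 * a - b \<ge> 2 \<or> a + 3 * b \<ge> 3"
  proof (rule ccontr)
    assume "\<not> ?thesis"
    then have *: "3 * a + 2 * b > 0" "2 * a - b < 2" "a + 3 * b < 3" by auto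
    \<comment> \<open>\<open>7a = 3(2a - b) + (a + 3b) \<le> 5\<close> and
      \<open>7b = 3(a + 3b) - (3a + 2b) \<le> 5\<close>.\<close>
    then have "a \<le> 0" "b \<le> 0" by linarith+
    then show False using *(1) by linarith
  qed
  then have "3 * real_of_int a + 2 * real_of_int b \<le> 0 \<or> 2 * real_of_int a - real_of_int b \<ge> 2
      \<or> real_of_int a + 3 * real_of_int b \<ge> 3"
    by linarith
  then show ?thesis by (auto simp: inner_2 vector_2 ab)
qed

lemma triangle_width:
  fixes c :: "real ^ 2"
  assumes "c \<in> integer_lattice" "c \<noteq> 0"
  shows "\<exists>u\<in>triangle. \<exists>v\<in>triangle. c \<bullet> u - c \<bullet> v \<ge> 9 - (- 6)"
proof -
  obtain a b :: int where ab: "c $ 1 = a" "c $ 2 = b" using lattice_2[OF assms(1)] .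
  have ne: "a \<noteq> 0 \<or> b \<noteq> 0" using assms(2) ab by (auto simp: vec_eq_iff forall_2)
  \<comment> \<open>The edge vectors are 5 times \<open>(2, -3)\<close>, \<open>(3, -1)\<close> and
    \<open>(1, 2)\<close> up to sign, so a value of 3 on one of these means width 15.\<close>
  have "\<bar>2 * a - 3 * b\<bar> \<ge> 3 \<or> \<bar>3 * a - b\<bar> \<ge> 3 \<or> \<bar>a + 2 * b\<bar> \<ge> 3"
  proof (rule ccontr)
    assume "\<not> ?thesis"
    then have *: "\<bar>2 * a - 3 * b\<bar> < 3" "\<bar>3 * a - b\<bar> < 3" "\<bar>a + 2 * b\<bar> < 3" by auto
    \<comment> \<open>\<open>7a = 2(3a - b) + (a + 2b)\<close> is at most 6 in absolute
      value.\<close>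
    then have "a = 0" by linarith
    then have "b = 0" using * by linarith
    then show False using \<open>a = 0\<close> ne by simp
  qed
  then have "real_of_int 3 \<le> real_of_int \<bar>2 * a - 3 * b\<bar> \<or> real_of_int 3 \<le> real_of_int \<bar>3 * a - b\<bar>
      \<or> real_of_int 3 \<le> real_of_int \<bar>a + 2 * b\<bar>"
    unfolding of_int_le_iff .
  moreover have False if "\<not> ?thesis"
    using that calculation
    by (simp add: triangle_def inner_2 vector_2 ab) (elim disjE; linarith)
  ultimately show ?thesis by blast
qed

section \<open>The 4-simplex\<close>

definition big_simplex :: "(real ^ 4) set" where
  "big_simplex = {0, vector [0, 102, 0, 0], vector [0, 0, 102, 0], vector [0, 0, 0, 102],
    vector [102 * 101, 102 * 6, 102 * 14, 102 * 17]}"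

lemma vector_4:
  "(vector [w, x, y, z] :: 'a::zero ^ 4) $ 1 = w"
  "(vector [w, x, y, z] :: 'a::zero ^ 4) $ 2 = x"
  "(vector [w, x, y, z] :: 'a::zero ^ 4) $ 3 = y"
  "(vector [w, x, y, z] :: 'a::zero ^ 4) $ 4 = z"
  by (simp_all add: vector_def)

lemma inner_4:
  "(x :: real ^ 4) \<bullet> y = x $ 1 * y $ 1 + x $ 2 * y $ 2 + x $ 3 * y $ 3 + x $ 4 * y $ 4"
  by (simp add: inner_vec_def sum_4)

lemma lattice_4:
  assumes "(z :: real ^ 4) \<in> integer_lattice"
  obtains a b c d :: int where "z $ 1 = a" "z $ 2 = b" "z $ 3 = c" "z $ 4 = d"
  using assms by (auto simp: integer_lattice_def forall_4 elim!: Ints_cases)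

text \<open>The empty simplex has width at least 4: the set holds the values at its vertices of the
  functional with coefficients \<open>a, b, c, d\<close>. The relation for \<open>v\<close> confines
  \<open>a\<close>, \<open>d\<close>, \<open>c\<close> in turn to absolute value at most 1, and the
  nonzero cases are excluded.\<close>

lemma small_width_zero:
  fixes a b c d v :: int
  assumes v: "v = 101 * a + 6 * b + 14 * c + 17 * d"
    and w: "\<And>x y. x \<in> {0, b, c, d, v} \<Longrightarrow> y \<in> {0, b, c, d, v} \<Longrightarrow> x - y \<le> 3"
  shows "a = 0 \<and> b = 0 \<and> c = 0 \<and> d = 0"
proof -
  have bounds: "b - 0 \<le> 3" "0 - b \<le> 3" "c - 0 \<le> 3" "0 - c \<le> 3" "d - 0 \<le> 3" "0 - d \<le> 3"
      "v - 0 \<le> 3" "0 - v \<le> 3" "b - c \<le> 3" "c - b \<le> 3" "b - d \<le> 3" "d - b \<le> 3"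
      "c - d \<le> 3" "d - c \<le> 3"
      "v - b \<le> 3" "c - v \<le> 3" "b - v \<le> 3" "v - c \<le> 3" "v - d \<le> 3" "d - v \<le> 3"
    by (rule w; simp)+
  have "a \<noteq> 1"
  proof
    assume "a = 1"
    \<comment> \<open>\<open>v - 6b - 14c - 17d\<close> never exceeds 111, so the value 101 forces
      \<open>d\<close> and then \<open>c\<close> to be extreme.\<close>
    then have "d = -3" using bounds v by linarith
    then have "c = -3" using bounds v \<open>a = 1\<close> by linarith
    then have *: "6 * b = v - 8" "-3 \<le> v" "v \<le> 0"
      using bounds v \<open>a = 1\<close> \<open>d = -3\<close> by linarith+
    then have "b \<ge> - 1" by linarith
    then show False using * by linarith
  qed
  moreover have "a \<noteq> -1"
  proof
    assume "a = -1"
    then have "d = 3" using bounds v by linarith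
    then have "c = 3" using bounds v \<open>a = -1\<close> by linarith
    then have *: "6 * b = v + 8" "v \<le> 3" "0 \<le> v"
      using bounds v \<open>a = -1\<close> \<open>d = 3\<close> by linarith+
    then have "b \<le> 1" by linarith
    then show False using * by linarith
  qed
  moreover have "a \<le> 1" "-1 \<le> a" using bounds v by linarith+
  ultimately have "a = 0" by linarith
  have "d \<noteq> 1"
  proof
    assume d: "d = 1"
    then have "c \<le> - 1" "c \<ge> - 2" using bounds v \<open>a = 0\<close> by linarith+
    then consider "c = - 1" | "c = - 2" by linarith
    then show False
    proof cases
      case 1
      then have "b \<ge> 0" using bounds v \<open>a = 0\<close> d by linarith
      then show False using 1 bounds v \<open>a = 0\<close> d by linarith
    next
      case 2
      then show False using bounds v \<open>a = 0\<close> d by linarith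
    qed
  qed
  have "d \<noteq> - 1"
  proof
    assume d: "d = - 1"
    then have "c \<ge> 1" "c \<le> 2" using bounds v \<open>a = 0\<close> by linarith+
    then consider "c = 1" | "c = 2" by linarith
    then show False
    proof cases
      case 1
      then have "b \<le> 0" using bounds v \<open>a = 0\<close> d by linarith
      then show False using 1 bounds v \<open>a = 0\<close> d by linarith
    next
      case 2
      then show False using bounds v \<open>a = 0\<close> d by linarith
    qed
  qed
  \<comment> \<open>\<open>37d = 6(d - b) + 14(d - c) + v\<close> when \<open>a = 0\<close>.\<close>
  moreover have "37 * d \<le> 63" "- 63 \<le> 37 * d" using bounds v \<open>a = 0\<close> by linarith+
  ultimately have d: "d = 0" using \<open>d \<noteq> 1\<close> by linarith
  have "c \<noteq> 1"
  proof
    assume c: "c = 1"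
    then have "b = - 2" using bounds v \<open>a = 0\<close> d by linarith
    then show False using c bounds v \<open>a = 0\<close> d by linarith
  qed
  have "c \<noteq> - 1"
  proof
    assume c: "c = - 1"
    then have "b = 2" using bounds v \<open>a = 0\<close> d by linarith
    then show False using c bounds v \<open>a = 0\<close> d by linarith
  qed
  \<comment> \<open>\<open>20c = 6(c - b) + v\<close> has absolute value at most 21.\<close>
  moreover have "c \<le> 1" "- 1 \<le> c" using bounds v \<open>a = 0\<close> d by linarith+
  ultimately have "c = 0" using \<open>c \<noteq> 1\<close> by linarith
  then have "b = 0" using bounds(7,8) v \<open>a = 0\<close> d by linarith
  then show ?thesis using \<open>a = 0\<close> d \<open>c = 0\<close> by blast
qed
lemma big_simplex_width:
  fixes e :: "real ^ 4"
  assumes "e \<in> integer_lattice" "e \<noteq> 0"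
  shows "\<exists>u\<in>big_simplex. \<exists>v\<in>big_simplex. e \<bullet> u - e \<bullet> v \<ge> 306 - (- 102)"
proof -
  obtain a b c d :: int where e: "e $ 1 = a" "e $ 2 = b" "e $ 3 = c" "e $ 4 = d"
    using lattice_4[OF assms(1)] .
  define v where "v = 101 * a + 6 * b + 14 * c + 17 * d"
  define X where "X = {0, b, c, d, v}"
  have img: "(\<lambda>u. e \<bullet> u) ` big_simplex = (\<lambda>x. 102 * real_of_int x) ` X"
    by (simp add: big_simplex_def X_def v_def inner_4 vector_4 e algebra_simps)
  have "\<exists>x\<in>X. \<exists>y\<in>X. x - y \<ge> 4"
  proof (rule ccontr)
    assume "\<not> ?thesis"
    then have le: "\<forall>x\<in>X. \<forall>y\<in>X. x - y \<le> 3" by force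
    have "a = 0 \<and> b = 0 \<and> c = 0 \<and> d = 0"
      by (intro small_width_zero[OF v_def]) (use le in \<open>unfold X_def, blast\<close>)
    then show False using assms(2) e by (auto simp: vec_eq_iff forall_4)
  qed
  then obtain x y where xy: "x \<in> X" "y \<in> X" "x - y \<ge> 4" by blast
  then have "102 * real_of_int x \<in> (\<lambda>u. e \<bullet> u) ` big_simplex"
      "102 * real_of_int y \<in> (\<lambda>u. e \<bullet> u) ` big_simplex"
    unfolding img by auto
  then obtain p q where "p \<in> big_simplex" "q \<in> big_simplex"
      "e \<bullet> p = 102 * real_of_int x" "e \<bullet> q = 102 * real_of_int y"
    unfolding image_iff by metis
  moreover have "102 * real_of_int x - 102 * real_of_int y \<ge> 408"
    using xy(3) by linarith
  ultimately show ?thesis by force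
qed

section \<open>Instantiation with 7 blocks of dimension 2 and 101 blocks of dimension 4\<close>

theorem theorem1p3:
  "(\<exists>P :: (real ^ 14) set.
      lattice_polytope P \<and> aff_dim P = 14 \<and> hollow P \<and> lattice_width P = 15) \<and>
   (\<exists>S :: (real ^ 404) set.
      404 simplex S \<and> lattice_polytope S \<and> hollow S \<and> lattice_width S = 408)"
proof
  obtain h :: "14 \<Rightarrow> 7 \<times> 2" where h: "bij h"
    by (rule blocks_exist[where 'n = 14 and 'b = 7 and 'd = 2]) simp
  let ?P = "free_power h triangle"
  have "lattice_polytope ?P"
    by (rule lattice_polytope_free_power[OF h])
      (auto simp: triangle_def integer_lattice_def forall_2 vector_2)
  moreover have "aff_dim ?P = 14"
  proof -
    have "a = 0" if "\<And>u. u \<in> triangle \<Longrightarrow> a \<bullet> u = 0" for a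
      using that[of "vector [4, -6]"] that[of "vector [9, 4]"]
      by (simp add: triangle_def inner_2 vector_2 vec_eq_iff forall_2)
    then have "aff_dim (generators h triangle) = CARD(14)"
      by (intro aff_dim_generators[OF h]) (auto simp: triangle_def)
    then show ?thesis by (simp add: free_power_def[OF h] aff_dim_convex_hull)
  qed
  moreover have "hollow ?P"
    by (rule hollow_free_power[OF h _ _ _ triangle_hollow])
      (auto simp: triangle_def inner_2 vector_2 vec_eq_iff forall_2)
  \<comment> \<open>The first coordinate ranges over \<open>[-6, 9]\<close> on the triangle.\<close>
  moreover have "lattice_width ?P = 9 - (- 6)"
    by (rule lattice_width_free_power[where c = "vector [1, 0]", OF h _ triangle_width])
      (auto simp: triangle_def inner_2 vector_2 vec_eq_iff forall_2 integer_lattice_def)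
  ultimately show "\<exists>P :: (real ^ 14) set.
      lattice_polytope P \<and> aff_dim P = 14 \<and> hollow P \<and> lattice_width P = 15"
    by auto
next
  obtain h :: "404 \<Rightarrow> 101 \<times> 4" where h: "bij h"
    by (rule blocks_exist[where 'n = 404 and 'b = 101 and 'd = 4]) simp
  let ?S = "free_power h big_simplex"
  have "lattice_polytope ?S"
    by (rule lattice_polytope_free_power[OF h])
      (auto simp: big_simplex_def integer_lattice_def forall_4 vector_4)
  moreover have "404 simplex ?S"
  proof -
    have "a = 0" if "\<And>u. u \<in> big_simplex \<Longrightarrow> a \<bullet> u = 0" for a
      using that[of "vector [0, 102, 0, 0]"] that[of "vector [0, 0, 102, 0]"]
        that[of "vector [0, 0, 0, 102]"] that[of "vector [102 * 101, 102 * 6, 102 * 14, 102 * 17]"]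
      by (simp add: big_simplex_def inner_4 vector_4 vec_eq_iff forall_4)
    moreover have "card big_simplex \<le> CARD(4) + 1"
      by (simp add: big_simplex_def card_insert_le_m1)
    ultimately have "int CARD(404) simplex ?S"
      by (intro simplex_free_power[OF h]) (auto simp: big_simplex_def)
    then show ?thesis by simp
  qed
  moreover have "hollow ?S"
  proof -
    let ?A = "{vector [-1, 0, 0, 0], vector [6, -101, 0, 0], vector [14, 0, -101, 0],
        vector [17, 0, 0, -101]} :: (real ^ 4) set"
    \<comment> \<open>The facet opposite the origin: \<open>36 = 6 + 14 + 17 - 1\<close> and
      \<open>10302 = 101 * 102\<close>.\<close>
    let ?B = "{vector [-36 / 10302, 1 / 102, 1 / 102, 1 / 102]} :: (real ^ 4) set"
    \<comment> \<open>Inside the cone of the simplex at the origin, a lattice point with first coordinate \<open>k\<close> has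
      its other coordinates at least these quotients plus \<open>1\<close>.\<close>
    have residues: "\<forall>k\<in>set [1..101].
        101 * (6 * k div 101 + 14 * k div 101 + 17 * k div 101 + 3) \<ge> 36 * k + (102::int)"
      by code_simp
    \<comment> \<open>The left side is 101 times the gauge of the undilated simplex. It is an
      integer, and emptiness makes it exceed 101 in the open cone.\<close>
    have cone: "101 * (b + c + d) - 36 * a \<ge> 102"
      if pos: "a > 0" "101 * b > 6 * a" "101 * c > 14 * a" "101 * d > 17 * a" for a b c d :: int
    proof (rule ccontr)
      assume neg: "\<not> ?thesis"
      \<comment> \<open>Adding the last three cone inequalities gives
        \<open>101 * (b + c + d) - 36 * a \<ge> a + 3\<close>, so failure of the bound leaves
        finitely many \<open>a\<close>.\<close>
      then have a: "a \<in> set [1..101]" using pos by simp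
      obtain p q r where pqr: "p = 6 * a div 101" "q = 14 * a div 101" "r = 17 * a div 101" by blast
      have "b \<ge> p + 1" "c \<ge> q + 1" "d \<ge> r + 1"
        unfolding pqr using pos by linarith+
      moreover have "101 * (p + q + r + 3) \<ge> 36 * a + 102"
        unfolding pqr by (rule bspec[OF residues a])
      ultimately have ?thesis by (simp add: algebra_simps)
      then show False using neg by blast
    qed
    have "(\<exists>g\<in>?A. g \<bullet> z \<ge> 0) \<or> (\<exists>g\<in>?B. g \<bullet> z \<ge> 1 / CARD(101))" if z_lat: "z \<in> integer_lattice" for z
    proof -
      obtain a b c d :: int where z: "z $ 1 = a" "z $ 2 = b" "z $ 3 = c" "z $ 4 = d"
        using lattice_4[OF z_lat] .
      have "a \<le> 0 \<or> 101 * b \<le> 6 * a \<or> 101 * c \<le> 14 * a \<or> 101 * d \<le> 17 * a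
          \<or> 101 * (b + c + d) - 36 * a \<ge> 102"
        using cone[of a b c d] by (meson not_le)
      then have "real_of_int a \<le> real_of_int 0 \<or> real_of_int (101 * b) \<le> real_of_int (6 * a)
          \<or> real_of_int (101 * c) \<le> real_of_int (14 * a)
          \<or> real_of_int (101 * d) \<le> real_of_int (17 * a)
          \<or> real_of_int (101 * (b + c + d) - 36 * a) \<ge> real_of_int 102"
        unfolding of_int_le_iff .
      moreover have False if "\<not> ?thesis"
        using that calculation by (simp add: inner_4 vector_4 z)
      ultimately show ?thesis by blast
    qed
    moreover have "0 \<notin> ?A"
      by (simp add: vec_eq_iff forall_4 vector_4)
    ultimately show ?thesis
      by (intro hollow_free_power[OF h, where A = ?A and B = ?B])
        (auto simp: big_simplex_def inner_4 vector_4)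
  qed
  \<comment> \<open>The witness takes the values \<open>0, 102, 102, -102\<close> and
    \<open>102 * (6 + 14 - 17) = 306\<close> at the vertices.\<close>
  moreover have "lattice_width ?S = 306 - (- 102)"
    by (rule lattice_width_free_power[where c = "vector [0, 1, 1, -1]", OF h _ big_simplex_width])
      (auto simp: big_simplex_def inner_4 vector_4 vec_eq_iff forall_4 integer_lattice_def)
  ultimately show "\<exists>S :: (real ^ 404) set.
      404 simplex S \<and> lattice_polytope S \<and> hollow S \<and> lattice_width S = 408"
    by auto
qed

end
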